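(* Let $\mathcal{W}=(D,A,B)$ be a web, where $D=(V,E)$ is a digraph of arbitrary (possibly infinite) cardinality. If $\mathcal{W}$ admits a wasteful partial linkage $\mathcal{P}$, i.e. a set $\mathcal{P}$ of pairwise vertex-disjoint $AB$-paths with $\left|A\setminus \mathsf{in}(\mathcal{P})\right|>\left|B\setminus \mathsf{ter}(\mathcal{P})\right|$ (cardinalities), then $\mathcal{W}$ is hindered.
   Context: A digraph is a pair $D=(V,E)$ with $E\subseteq (V\times V)\setminus\{vv: v\in V\}$ such that $uv\in E$ implies $vu\notin E$. A web is a triple $(D,A,B)$ with $D=(V,E)$ a digraph and $A,B\subseteq V$ such that no vertex of $A$ has an ingoing edge and no vertex of $B$ has an outgoing edge. A path is either a single vertex (trivial path) or a finite directed path $v_0v_1,\dots,v_{n-1}v_n$ with $v_iv_{i+1}\in E$ and no repeated vertices; $\mathsf{in}$ and $\mathsf{ter}$ denote its initial and terminal vertex (both equal to $v$ for a trivial path $v$). For sets $X,Y$, an $XY$-path is either a trivial path at a vertex of $X\cap Y$, or a nontrivial path with $v_0\in X$, $v_n\in Y$ and $v_i\notin X\cup Y$ for $0<i<n$. For a set $\mathcal{P}$ of paths, $\mathsf{in}(\mathcal{P})$ and $\mathsf{ter}(\mathcal{P})$ are the sets of initial and terminal vertices of its members. An $XY$-separator is a set $S\subseteq V$ meeting every $XY$-path. A hindrance of $(D,A,B)$ is a set $\mathcal{H}$ of pairwise vertex-disjoint $AS$-paths, where $S$ is an $AB$-separator, such that $\mathsf{ter}(\mathcal{H})=S$ and $\mathsf{in}(\mathcal{H})\subsetneq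 A$. The web is hindered if it has a hindrance. *)

theory Defs
  imports
    "HOL-Library.Equipollence"
    "Graph_Theory.Pair_Digraph"
    "Graph_Theory.Vertex_Walk"
begin

text \<open>
  The locale \<open>digraph\<close> of the Graph Theory entry demands finiteness, so digraphs of arbitrary
  cardinality are built on \<open>pair_loopfree_digraph\<close>, which gives that the arcs are
  pairs of distinct vertices.
\<close>

locale oriented_digraph = pair_loopfree_digraph D for D :: "'v pair_pre_digraph" +
  assumes no_antiparallel: "(u, v) \<in> parcs D \<Longrightarrow> (v, u) \<notin> parcs D"

locale web = oriented_digraph D for D :: "'v pair_pre_digraph" +
  fixes A B :: "'v set"
  assumes A_subset: "A \<subseteq> pverts D"
    and B_subset: "B \<subseteq> pverts D"
    and no_arc_into_A: "a \<in> A \<Longrightarrow> (u, a) \<notin> parcs D"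
    and no_arc_from_B: "b \<in> B \<Longrightarrow> (b, u) \<notin> parcs D"

text \<open>
  A path is the nonempty distinct list of its vertices, a trivial path being a one-element list;
  its initial and terminal vertex are the \<open>hd\<close> and the \<open>last\<close> of the list.
\<close>

abbreviation dpath :: "'v pair_pre_digraph \<Rightarrow> 'v list \<Rightarrow> bool" where
  "dpath D p \<equiv> vpath p (with_proj D)"

abbreviation initials :: "'v list set \<Rightarrow> 'v set" where
  "initials P \<equiv> hd ` P"

abbreviation terminals :: "'v list set \<Rightarrow> 'v set" where
  "terminals P \<equiv> last ` P"

text \<open>
  Only interior vertices have to avoid \<open>X \<union> Y\<close>: the initial vertex of a nontrivial path may
  also lie in \<open>Y\<close> and the terminal vertex in \<open>X\<close>.
\<close>

definition path_between :: "'v pair_pre_digraph \<Rightarrow> 'v set \<Rightarrow> 'v set \<Rightarrow> 'v list \<Rightarrow> bool" where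
  "path_between D X Y p \<longleftrightarrow> dpath D p \<and>
     ((\<exists>v. p = [v] \<and> v \<in> X \<inter> Y) \<or>
      (length p > 1 \<and> hd p \<in> X \<and> last p \<in> Y \<and>
       (\<forall>i. 0 < i \<and> i < length p - 1 \<longrightarrow> p ! i \<notin> X \<union> Y)))"

definition vertex_disjoint :: "'v list set \<Rightarrow> bool" where
  "vertex_disjoint P \<longleftrightarrow> pairwise (\<lambda>p q. disjnt (set p) (set q)) P"

definition separator :: "'v pair_pre_digraph \<Rightarrow> 'v set \<Rightarrow> 'v set \<Rightarrow> 'v set \<Rightarrow> bool" where
  "separator D X Y S \<longleftrightarrow>
     S \<subseteq> pverts D \<and> (\<forall>p. path_between D X Y p \<longrightarrow> set p \<inter> S \<noteq> {})"

definition hindrance :: "'v pair_pre_digraph \<Rightarrow> 'v set \<Rightarrow> 'v set \<Rightarrow> 'v list set \<Rightarrow> bool" where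
  "hindrance D A B H \<longleftrightarrow>
     (\<exists>S. separator D A B S \<and> (\<forall>p\<in>H. path_between D A S p) \<and> vertex_disjoint H \<and>
          terminals H = S \<and> initials H \<subset> A)"

definition hindered :: "'v pair_pre_digraph \<Rightarrow> 'v set \<Rightarrow> 'v set \<Rightarrow> bool" where
  "hindered D A B \<longleftrightarrow> (\<exists>H. hindrance D A B H)"

definition partial_linkage :: "'v pair_pre_digraph \<Rightarrow> 'v set \<Rightarrow> 'v set \<Rightarrow> 'v list set \<Rightarrow> bool" where
  "partial_linkage D A B P \<longleftrightarrow> (\<forall>p\<in>P. path_between D A B p) \<and> vertex_disjoint P"

definition wasteful :: "'v set \<Rightarrow> 'v set \<Rightarrow> 'v list set \<Rightarrow> bool" where
  "wasteful A B P \<longleftrightarrow> B - terminals P \<prec> A - initials P"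

end

theory Submission
  imports Defs "HOL-Library.Disjoint_Sets"
begin

text \<open>
  Split every vertex into a left copy (where paths leave it) and a right copy (where paths enter
  it). A partial linkage becomes a matching of this bipartite graph, with a vertex off the linkage
  matched to itself; the unmatched left vertices are \<open>U = A - B - in(P)\<close>, the
  unmatched right ones \<open>T = B - A - ter(P)\<close>, and \<open>U\<close> is larger than
  \<open>T\<close>. It suffices to find a set \<open>C\<close> of left vertices whose
  neighbourhood is matched into \<open>C\<close> avoiding some element of \<open>U\<close>: following
  the matching backwards from the right vertices at which \<open>C\<close> is left, one reaches
  \<open>A\<close> along the paths of a hindrance. That this takes finitely many steps is
  ensured by a labelling with finite fibres that the matching preserves; initially the label of a
  vertex names its path in \<open>P\<close>.

  If \<open>T\<close> is finite, augment along alternating paths from \<open>U\<close> to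
  \<open>T\<close> as long as possible, and then take for \<open>C\<close> all that is reachable from
  \<open>U\<close>. If \<open>T\<close> is infinite, call a right vertex popular if no set of at most
  \<open>|T|\<close> labels meets all alternating paths from \<open>U\<close> to it. Some set
  \<open>K\<close> of at most \<open>|T|\<close> labels contains those of \<open>T\<close> and, with the label
  of an unpopular vertex, a set of labels separating it from \<open>U\<close>. Let \<open>C\<close> be what
  can be reached from \<open>U\<close> outside \<open>K\<close>. The neighbours of \<open>C\<close> inside
  \<open>K\<close> are popular and at most \<open>|T|\<close> many, so alternating paths to all of them can
  be chosen with disjoint label sets. Augmenting along all these paths at once keeps the fibres finite.
\<close>

section \<open>Alternating walks\<close>

text \<open>
  An alternating walk is given by its left start and the list of its right vertices; the
  intermediate left vertices are their partners under \<open>m\<close>, the map from right to left.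
\<close>

fun alt_walk :: "('v \<Rightarrow> 'v \<Rightarrow> bool) \<Rightarrow> ('v \<Rightarrow> 'v) \<Rightarrow> 'v \<Rightarrow> 'v list \<Rightarrow> bool" where
  "alt_walk E m x [] \<longleftrightarrow> True"
| "alt_walk E m x (r # rs) \<longleftrightarrow> E x r \<and> alt_walk E m (m r) rs"

text \<open>The matching after augmenting along the walk: each right vertex on it is given the left
  vertex just before it.\<close>

fun shift :: "('v \<Rightarrow> 'v) \<Rightarrow> 'v \<Rightarrow> 'v list \<Rightarrow> 'v \<Rightarrow> 'v" where
  "shift m x [] = m"
| "shift m x (r # rs) = (shift m (m r) rs)(r := x)"

inductive_set reach :: "('v \<Rightarrow> 'v \<Rightarrow> bool) \<Rightarrow> ('v \<Rightarrow> 'v) \<Rightarrow> 'v set \<Rightarrow> 'v set \<Rightarrow> 'v set"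
  for E m N U where
  base: "u \<in> U \<Longrightarrow> u \<in> reach E m N U"
| step: "x \<in> reach E m N U \<Longrightarrow> E x r \<Longrightarrow> r \<in> N \<Longrightarrow> m r \<in> reach E m N U"

lemma alt_walk_append:
  "alt_walk E m x (rs @ [r]) \<longleftrightarrow>
     alt_walk E m x rs \<and> E (if rs = [] then x else m (last rs)) r"
  by (induction rs arbitrary: x) auto

lemma alt_walk_takeD: "alt_walk E m x (rs @ qs) \<Longrightarrow> alt_walk E m x rs"
  by (induction rs arbitrary: x) auto

lemma reach_alt_walk:
  assumes "x \<in> reach E m N U"
  shows "\<exists>u\<in>U. \<exists>rs. alt_walk E m u rs \<and> distinct rs \<and> set rs \<subseteq> N \<and>
           x = (if rs = [] then u else m (last rs))"
  using assms
proof induction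
  case (base u)
  then show ?case by (intro bexI[of _ u] exI[of _ "[]"]) auto
next
  case (step x r)
  then obtain u rs where u: "u \<in> U" and rs: "alt_walk E m u rs" "distinct rs" "set rs \<subseteq> N"
    and x: "x = (if rs = [] then u else m (last rs))" by blast
  show ?case
  \<comment> \<open>A walk returning to \<open>r\<close> is cut back to its earlier visit, since the
    position \<open>m r\<close> depends on \<open>r\<close> alone.\<close>
  proof (cases "r \<in> set rs")
    case True
    then obtain as bs where "rs = as @ r # bs" by (meson split_list)
    then have split: "rs = (as @ [r]) @ bs" by simp
    then have "alt_walk E m u (as @ [r])" using rs(1) alt_walk_takeD by metis
    with u rs split show ?thesis
      by (intro bexI[of _ u] exI[of _ "as @ [r]"]) auto
  next
    case False
    with u rs x step show ?thesis
      by (intro bexI[of _ u] exI[of _ "rs @ [r]"]) (auto simp: alt_walk_append)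
  qed
qed

lemma reach_edge_alt_walk:
  assumes "x \<in> reach E m N U" and "E x y"
  obtains u rs where "u \<in> U" "alt_walk E m u (rs @ [y])" "distinct rs" "set rs \<subseteq> N"
proof -
  from reach_alt_walk[OF assms(1)] obtain u rs where "u \<in> U" "alt_walk E m u rs" "distinct rs"
    "set rs \<subseteq> N" "x = (if rs = [] then u else m (last rs))" by blast
  then show ?thesis using that[of u rs] assms(2) by (simp add: alt_walk_append)
qed

lemma alt_walk_reach:
  assumes "alt_walk E m x (rs @ qs)" "x \<in> reach E m N U" "set rs \<subseteq> N"
  shows "m ` set rs \<subseteq> reach E m N U"
  using assms by (induction rs arbitrary: x) (auto intro: reach.step)

lemma shift_outside: "r \<notin> set rs \<Longrightarrow> shift m x rs r = m r"
  by (induction rs arbitrary: x) auto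

text \<open>Peel off the first right vertex \<open>r\<close>: rematching it to \<open>u\<close>
  frees \<open>m r\<close>, which starts the rest of the walk and, by injectivity, is not the
  partner of a later vertex of \<open>rs\<close>.\<close>

lemma shift_alt_walk:
  assumes "alt_walk E m u (rs @ [y])" "distinct (rs @ [y])" "inj_on m (set rs)" "u \<notin> m ` set rs"
  shows "inj_on (shift m u (rs @ [y])) (insert y (set rs))"
    and "shift m u (rs @ [y]) ` insert y (set rs) = insert u (m ` set rs)"
    and "\<forall>r\<in>insert y (set rs). E (shift m u (rs @ [y]) r) r"
  using assms
proof (induction rs arbitrary: u)
  case Nil
  { case 1 then show ?case by auto next case 2 then show ?case by auto next
    case 3 then show ?case by auto }
next
  case (Cons r rs)
  let ?M = "shift m (m r) (rs @ [y])"
  have IH: "inj_on ?M (insert y (set rs))" "?M ` insert y (set rs) = insert (m r) (m ` set rs)"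
    "\<forall>r\<in>insert y (set rs). E (?M r) r"
    if "alt_walk E m u (r # rs @ [y])" "distinct (r # rs @ [y])" "inj_on m (insert r (set rs))" for u
    using that by (intro Cons.IH; auto)+
  have eq: "shift m u ((r # rs) @ [y]) = ?M(r := u)" for u by simp
  have sets: "insert y (set (r # rs)) = insert r (insert y (set rs))" by auto
  have img: "(?M(r := u)) ` insert y (set rs) = ?M ` insert y (set rs)"
    if "distinct ((r # rs) @ [y])" for u
    using that by (intro image_cong) auto
  { case 1
    note I = IH[of u]
    from 1 have r: "r \<notin> insert y (set rs)" by auto
    have "inj_on (?M(r := u)) (insert y (set rs))"
      using I(1) 1 r by (subst inj_on_cong[of _ _ ?M]) auto
    moreover have "u \<notin> (?M(r := u)) ` insert y (set rs)"
      unfolding img[OF 1(2)] using I(2) 1 by auto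
    ultimately show ?case unfolding eq sets using r by (subst inj_on_insert) auto
  next
    case 2
    then show ?case unfolding eq sets image_insert[of _ r] img[OF 2(2)] using IH(2)[of u] by auto
  next
    case 3
    then show ?case unfolding eq sets using IH(3)[of u] by auto }
qed

text \<open>
  All labels met by one of the walks are merged into a single label: the fibres stay finite, and the
  new matching preserves labels although it runs between old fibres.
\<close>

lemma augment:
  fixes g :: "'v \<Rightarrow> 'g"
  assumes inj: "inj_on m N" and Y: "Y \<inter> N = {}" and edge: "\<And>r. r \<in> N \<Longrightarrow> E (m r) r"
    and walk: "\<And>y. y \<in> Y \<Longrightarrow> alt_walk E m (u y) (rs y @ [y])"
    and dist: "\<And>y. y \<in> Y \<Longrightarrow> distinct (rs y)" and sub: "\<And>y. y \<in> Y \<Longrightarrow> set (rs y) \<subseteq> N"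
    and u: "\<And>y. y \<in> Y \<Longrightarrow> u y \<notin> m ` N"
    and lab: "\<And>r. r \<in> N \<Longrightarrow> g (m r) = g r" and fin: "\<And>l. finite (g -` {l})"
    and Gu: "\<And>y. y \<in> Y \<Longrightarrow> g (u y) \<in> G y" and Grs: "\<And>y. y \<in> Y \<Longrightarrow> g ` set (rs y) \<subseteq> G y"
    and Gfin: "\<And>y. y \<in> Y \<Longrightarrow> finite (G y)" and Gdisj: "disjoint_family_on G Y"
  obtains m' and g' :: "'v \<Rightarrow> 'g" where "inj_on m' (N \<union> Y)" "\<And>r. r \<in> N \<union> Y \<Longrightarrow> E (m' r) r"
    "\<And>r. r \<in> N \<union> Y \<Longrightarrow> r \<in> N \<and> m' r = m r \<or> (\<exists>y\<in>Y. m' r \<in> insert (u y) (m ` set (rs y)))"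
    "\<And>r. r \<in> N \<Longrightarrow> g' (m' r) = g' r" "\<And>y. y \<in> Y \<Longrightarrow> g y \<in> G y \<Longrightarrow> g' (m' y) = g' y"
    "\<And>l. finite (g' -` {l})"
proof -
  \<comment> \<open>\<open>Q y\<close> and \<open>Z y\<close> are the right and left vertices of the
    walk to \<open>y\<close>, and \<open>M y\<close> is \<open>m\<close> shifted along it. Disjoint
    label sets keep different walks apart, so the local rematchings can be glued.\<close>
  define Q where "Q y = insert y (set (rs y))" for y
  define M where "M y = shift m (u y) (rs y @ [y])" for y
  define Z where "Z y = insert (u y) (m ` set (rs y))" for y
  have uniqG: "y = z" if "y \<in> Y" "z \<in> Y" "l \<in> G y" "l \<in> G z" for y z l
    using Gdisj that unfolding disjoint_family_on_def by blast
  have ZG: "g ` Z y \<subseteq> G y" if "y \<in> Y" for y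
    using Gu[OF that] Grs[OF that] lab sub[OF that] unfolding Z_def by auto
  have uniqQ: "y = z" if Qs: "y \<in> Y" "z \<in> Y" "r \<in> Q y" "r \<in> Q z" for y z r
  proof -
    \<comment> \<open>The label of a target \<open>y\<close> need not belong to \<open>G y\<close>;
      targets are told apart from inner vertices by lying outside \<open>N\<close>.\<close>
    have "y \<notin> set (rs z)" "z \<notin> set (rs y)" using Qs sub Y by blast+
    then consider "r \<in> set (rs y)" "r \<in> set (rs z)" | "r = y" "r = z"
      using Qs unfolding Q_def by auto
    then show ?thesis
    proof cases
      case 1
      then have "g r \<in> G y" "g r \<in> G z" using Grs Qs by blast+
      then show ?thesis using uniqG Qs by blast
    qed simp
  qed
  define m' where "m' r = (if \<exists>y\<in>Y. r \<in> Q y then M (THE y. y \<in> Y \<and> r \<in> Q y) r else m r)" for r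
  have m'Q: "m' r = M y r" if "y \<in> Y" "r \<in> Q y" for y r
  proof -
    have "(THE y. y \<in> Y \<and> r \<in> Q y) = y" using that uniqQ by blast
    then show ?thesis using that unfolding m'_def by auto
  qed
  have m'N: "m' r = m r" if "\<And>y. y \<in> Y \<Longrightarrow> r \<notin> Q y" for r
    using that unfolding m'_def by auto
  have S: "inj_on (M y) (Q y)" "M y ` Q y = Z y" "\<forall>r\<in>Q y. E (M y r) r" if "y \<in> Y" for y
    unfolding M_def Q_def Z_def using walk dist u sub Y that inj
    by (intro shift_alt_walk; fastforce intro: inj_on_subset)+
  have m'Z: "m' r \<in> Z y" if "y \<in> Y" "r \<in> Q y" for y r
    using m'Q[OF that] S(2)[OF that(1)] that(2) by blast
  define g' where "g' v = (if \<exists>y\<in>Y. g v \<in> G y then g (u (THE y. y \<in> Y \<and> g v \<in> G y)) else g v)" for v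
  have g'G: "g' v = g (u y)" if "y \<in> Y" "g v \<in> G y" for y v
  proof -
    have "(THE y. y \<in> Y \<and> g v \<in> G y) = y" using that uniqG by blast
    then show ?thesis using that unfolding g'_def by auto
  qed
  have g'N: "g' v = g v" if "\<And>y. y \<in> Y \<Longrightarrow> g v \<notin> G y" for v
    using that unfolding g'_def by auto
  show ?thesis
  proof (rule that[of m' g'])
    show "inj_on m' (N \<union> Y)"
    proof (rule inj_onI)
      fix r s assume r: "r \<in> N \<union> Y" and s: "s \<in> N \<union> Y" and eq: "m' r = m' s"
      \<comment> \<open>Here \<open>s\<close> lies on no walk. A shared partner is not the unmatched
        \<open>u y\<close>, so it is the partner of a vertex of \<open>rs y\<close>, which
        injectivity identifies with \<open>s\<close>.\<close>
      have mixed: False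
        if "y \<in> Y" "r \<in> Q y" "\<And>y. y \<in> Y \<Longrightarrow> s \<notin> Q y" "m' r = m' s" "s \<in> N \<union> Y" for r s y
      proof -
        have "m s \<in> Z y" using m'Z[OF that(1,2)] m'N[OF that(3)] that(4) by simp
        moreover have "s \<in> N" using that(3)[of s] that(5) unfolding Q_def by blast
        moreover from this have "m s \<noteq> u y" using u[OF that(1)] by (metis imageI)
        ultimately have "s \<in> set (rs y)"
          using sub[OF that(1)] inj unfolding Z_def by (auto dest: inj_onD)
        then show False using that(3)[OF that(1)] unfolding Q_def by blast
      qed
      consider y z where "y \<in> Y" "r \<in> Q y" "z \<in> Y" "s \<in> Q z"
        | "\<And>y. y \<in> Y \<Longrightarrow> r \<notin> Q y" "\<And>y. y \<in> Y \<Longrightarrow> s \<notin> Q y"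
        using mixed[OF _ _ _ eq s] mixed[OF _ _ _ eq[symmetric] r] by blast
      then show "r = s"
      proof cases
        case 1
        then have "m' r \<in> Z y" "m' s \<in> Z z" using m'Z by auto
        then have "g (m' r) \<in> G y" "g (m' r) \<in> G z" using ZG[OF 1(1)] ZG[OF 1(3)] eq by auto
        then have "y = z" using uniqG 1 by blast
        then show ?thesis using inj_onD[OF S(1)[OF 1(1)]] 1 eq m'Q by metis
      next
        case 2
        have "r \<in> N" "s \<in> N" using r s 2(1)[of r] 2(2)[of s] unfolding Q_def by blast+
        then show ?thesis using eq m'N[OF 2(1)] m'N[OF 2(2)] inj by (auto dest: inj_onD)
      qed
    qed
    show "E (m' r) r" if "r \<in> N \<union> Y" for r
    proof (cases "\<exists>y\<in>Y. r \<in> Q y")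
      case True then show ?thesis using S(3) m'Q by metis
    next
      case False
      then have "m' r = m r" "r \<in> N" using that m'N[of r] unfolding Q_def by blast+
      then show ?thesis using edge by simp
    qed
    show "r \<in> N \<and> m' r = m r \<or> (\<exists>y\<in>Y. m' r \<in> insert (u y) (m ` set (rs y)))" if "r \<in> N \<union> Y" for r
    proof (cases "\<exists>y\<in>Y. r \<in> Q y")
      case True
      then obtain y where "y \<in> Y" "m' r \<in> Z y" using m'Z by blast
      then show ?thesis unfolding Z_def by blast
    next
      case False
      then have "m' r = m r" "r \<in> N" using that m'N[of r] unfolding Q_def by blast+
      then show ?thesis by simp
    qed
    have touched: "g' (m' r) = g' r" if "y \<in> Y" "r \<in> Q y" "g r \<in> G y" for r y
    proof -
      have "g (m' r) \<in> G y" using m'Z[OF that(1,2)] ZG[OF that(1)] by blast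
      then show ?thesis using g'G[of y] that by simp
    qed
    show "g' (m' r) = g' r" if "r \<in> N" for r
    proof (cases "\<exists>y\<in>Y. r \<in> Q y")
      case True
      then obtain y where "y \<in> Y" "r \<in> Q y" by blast
      then show ?thesis using touched[of y r] Grs[of y] that Y unfolding Q_def by auto
    next
      case False
      then have "m' r = m r" using m'N[of r] by blast
      then show ?thesis using lab[OF that] unfolding g'_def by simp
    qed
    show "g' (m' y) = g' y" if "y \<in> Y" "g y \<in> G y" for y
      using touched[of y y] that unfolding Q_def by auto
    show "finite (g' -` {l})" for l
    proof -
      \<comment> \<open>A new fibre exceeds the old one at most by the vertices with labels in the
        one set \<open>G y\<close> containing \<open>l\<close>.\<close>
      have "g' -` {l} \<subseteq> g -` {l} \<union> (if \<exists>y\<in>Y. l \<in> G y then g -` G (THE y. y \<in> Y \<and> l \<in> G y) else {})"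
      proof
        fix v assume v: "v \<in> g' -` {l}"
        show "v \<in> g -` {l} \<union> (if \<exists>y\<in>Y. l \<in> G y then g -` G (THE y. y \<in> Y \<and> l \<in> G y) else {})"
        proof (cases "\<exists>y\<in>Y. g v \<in> G y")
          case True
          then obtain y where y: "y \<in> Y" "g v \<in> G y" by blast
          then have l: "l = g (u y)" using v g'G by auto
          then have "(THE y. y \<in> Y \<and> l \<in> G y) = y" using y Gu uniqG by blast
          then show ?thesis using y l Gu by auto
        next
          case False then show ?thesis using v g'N[of v] by auto
        qed
      qed
      moreover have "finite (g -` G (THE y. y \<in> Y \<and> l \<in> G y))" if "\<exists>y\<in>Y. l \<in> G y"
      proof -
        from that obtain y where y: "y \<in> Y" "l \<in> G y" by blast
        then have "(THE y. y \<in> Y \<and> l \<in> G y) = y" using uniqG by blast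
        moreover have "g -` G y = (\<Union>l\<in>G y. g -` {l})" by auto
        ultimately show ?thesis using Gfin[OF y(1)] fin by simp
      qed
      ultimately show ?thesis using fin by (elim finite_subset) auto
    qed
  qed
qed

section \<open>Obstructions in labelled matchings\<close>

definition neighbours :: "('v \<Rightarrow> 'v \<Rightarrow> bool) \<Rightarrow> 'v set \<Rightarrow> 'v set" where
  "neighbours E C = {r. \<exists>x\<in>C. E x r}"

text \<open>
  Labels have the type of vertices, because the type of \<open>g\<close> has to occur in that of
  \<open>obstructed\<close>.
\<close>

definition obstructed :: "('v \<Rightarrow> 'v \<Rightarrow> bool) \<Rightarrow> 'v set \<Rightarrow> bool" where
  "obstructed E U \<longleftrightarrow> (\<exists>C m a (g :: 'v \<Rightarrow> 'v). a \<in> U \<inter> C \<and> C \<subseteq> U \<union> {x. \<exists>r. E x r} \<and>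
     inj_on m (neighbours E C) \<and> m ` neighbours E C \<subseteq> C - {a} \<and>
     (\<forall>r\<in>neighbours E C. E (m r) r) \<and> (\<forall>l. finite (g -` {l})) \<and>
     (\<forall>r\<in>C \<inter> neighbours E C. g (m r) = g r))"

lemma obstructed_mono: "obstructed E U \<Longrightarrow> U \<subseteq> V \<Longrightarrow> obstructed E V"
  unfolding obstructed_def
  by (elim exE, rule exI, rule exI, rule exI, rule exI) (elim conjE, intro conjI; (assumption | blast))

lemma reach_subset:
  assumes "x \<in> reach E m N U" "\<And>r. r \<in> N \<Longrightarrow> E (m r) r"
  shows "x \<in> U \<union> {x. \<exists>r. E x r}"
  using assms by induction auto

lemma obstructed_by_augmenting:
  fixes g :: "'v \<Rightarrow> 'v"
  assumes inj: "inj_on m N" and Y: "Y \<inter> N = {}" and edge: "\<And>r. r \<in> N \<Longrightarrow> E (m r) r"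
    and lab: "\<And>r. r \<in> N \<Longrightarrow> g (m r) = g r" and fin: "\<And>l. finite (g -` {l})"
    and U: "U \<inter> m ` N = {}"
    and nb: "neighbours E (reach E m N U) \<subseteq> N \<union> Y"
    and C_Y: "reach E m N U \<inter> Y = {}"
    and u: "\<And>y. y \<in> Y \<Longrightarrow> u y \<in> U"
    and walk: "\<And>y. y \<in> Y \<Longrightarrow> alt_walk E m (u y) (rs y @ [y])"
    and dist: "\<And>y. y \<in> Y \<Longrightarrow> distinct (rs y)" and sub: "\<And>y. y \<in> Y \<Longrightarrow> set (rs y) \<subseteq> N"
    and Gdisj: "disjoint_family_on (\<lambda>y. g ` insert (u y) (set (rs y))) Y"
    and a: "a \<in> U" "a \<notin> u ` Y"
  shows "obstructed E U"
proof -
  let ?C = "reach E m N U"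
  have uN: "u y \<notin> m ` N" if "y \<in> Y" for y using u[OF that] U by blast
  obtain m' and g' :: "'v \<Rightarrow> 'v" where inj': "inj_on m' (N \<union> Y)"
    and edge': "\<And>r. r \<in> N \<union> Y \<Longrightarrow> E (m' r) r"
    and m': "\<And>r. r \<in> N \<union> Y \<Longrightarrow> r \<in> N \<and> m' r = m r \<or> (\<exists>y\<in>Y. m' r \<in> insert (u y) (m ` set (rs y)))"
    and lab': "\<And>r. r \<in> N \<Longrightarrow> g' (m' r) = g' r" and fin': "\<And>l. finite (g' -` {l})"
    by (rule augment[OF inj Y edge walk dist sub uN lab fin _ _ _ Gdisj]) auto
  have "m' ` neighbours E ?C \<subseteq> ?C - {a}"
  proof
    fix v assume "v \<in> m' ` neighbours E ?C"
    then obtain r where r: "r \<in> neighbours E ?C" and v: "v = m' r" by blast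
    then consider "r \<in> N" "v = m r" | y where "y \<in> Y" "v \<in> insert (u y) (m ` set (rs y))"
      using m'[of r] nb by blast
    then show "v \<in> ?C - {a}"
    proof cases
      case 1
      then have "v \<in> ?C" using r unfolding neighbours_def by (auto intro: reach.step)
      moreover have "v \<noteq> a" using 1 a(1) U by blast
      ultimately show ?thesis by blast
    next
      case 2
      have "m ` set (rs y) \<subseteq> ?C"
        using alt_walk_reach[OF walk] u sub 2(1) reach.base by metis
      moreover have "u y \<in> ?C" "u y \<noteq> a" using u[OF 2(1)] a(2) 2(1) by (auto intro: reach.base)
      moreover have "a \<notin> m ` set (rs y)" using a(1) U sub[OF 2(1)] by blast
      ultimately show ?thesis using 2(2) by blast
    qed
  qed
  moreover have "?C \<subseteq> U \<union> {x. \<exists>r. E x r}" using reach_subset[of _ E m N U] edge by blast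
  moreover have "a \<in> U \<inter> ?C" using a by (auto intro: reach.base)
  moreover have "\<forall>r\<in>?C \<inter> neighbours E ?C. g' (m' r) = g' r" using C_Y nb lab' by blast
  moreover have "inj_on m' (neighbours E ?C)" using inj' nb by (rule inj_on_subset)
  ultimately show ?thesis
    unfolding obstructed_def using edge' nb fin'
    by (rule_tac exI[of _ ?C], rule_tac exI[of _ m'], rule_tac exI[of _ a], rule_tac exI[of _ g']) blast
qed

text \<open>\<open>T\<close> consists of the unmatched right vertices. One labelling serves both
  copies of a vertex, so labels persist while the matching is followed from copy to copy.\<close>

locale labelled_matching =
  fixes E :: "'v \<Rightarrow> 'v \<Rightarrow> bool" and R T U :: "'v set" and m g :: "'v \<Rightarrow> 'v"
  assumes range: "E x r \<Longrightarrow> r \<in> R"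
    and inj: "inj_on m (R - T)"
    and edge: "r \<in> R - T \<Longrightarrow> E (m r) r"
    and unmatched: "U \<inter> m ` (R - T) = {}"
    and label: "r \<in> R - T \<Longrightarrow> g (m r) = g r"
    and fibre: "finite (g -` {l})"

section \<open>Finitely many unmatched right vertices\<close>

lemma obstructed_if_finite:
  fixes g :: "'v \<Rightarrow> 'v"
  assumes "finite T" "labelled_matching E R T U m g" "\<not> U \<lesssim> T"
  shows "obstructed E U"
  using assms
proof (induction "card T" arbitrary: T U m g rule: less_induct)
  case less
  interpret labelled_matching E R T U m g by fact
  let ?C = "reach E m (R - T) U"
  show ?case
  proof (cases "neighbours E ?C \<inter> T = {}")
    case True
    have "U \<noteq> {}" using less.prems(3) by auto
    then obtain a where "a \<in> U" by blast
    then show ?thesis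
      using True range inj edge label fibre unmatched
      by (intro obstructed_by_augmenting[where N = "R - T" and Y = "{}" and g = g and m = m and a = a])
         (auto simp: neighbours_def disjoint_family_on_def)
  next
    case False
    then obtain x t where xt: "x \<in> ?C" "E x t" "t \<in> T" unfolding neighbours_def by blast
    then obtain u rs where u: "u \<in> U" "alt_walk E m u (rs @ [t])" "distinct rs" "set rs \<subseteq> R - T"
      using reach_edge_alt_walk by metis
    have t: "t \<in> R" using xt range by blast
    have R: "R - (T - {t}) = (R - T) \<union> {t}" using t xt by auto
    have "u \<notin> m ` (R - T)" using u(1) unmatched by blast
    \<comment> \<open>The label of \<open>t\<close> is merged as well, because \<open>t\<close>
      becomes matched and has to satisfy \<open>label\<close> in the next round.\<close>
    then obtain m' and g' :: "'v \<Rightarrow> 'v" where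
      m': "inj_on m' ((R - T) \<union> {t})" "\<And>r. r \<in> (R - T) \<union> {t} \<Longrightarrow> E (m' r) r"
      "\<And>r. r \<in> (R - T) \<union> {t} \<Longrightarrow> r \<in> R - T \<and> m' r = m r \<or> m' r \<in> insert u (m ` set rs)"
      "\<And>r. r \<in> R - T \<Longrightarrow> g' (m' r) = g' r" "g' (m' t) = g' t" "\<And>l. finite (g' -` {l})"
      using u xt(3)
      by (rule_tac augment[where N = "R - T" and Y = "{t}" and u = "\<lambda>_. u" and rs = "\<lambda>_. rs"
            and G = "\<lambda>y. g ` insert y (insert u (set rs))" and g = g and m = m and E = E])
        (auto simp: inj edge label fibre disjoint_family_on_def)
    have "labelled_matching E R (T - {t}) (U - {u}) m' g'"
    proof
      show "E x r \<Longrightarrow> r \<in> R" for x r by (rule range)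
      show "inj_on m' (R - (T - {t}))" "r \<in> R - (T - {t}) \<Longrightarrow> E (m' r) r"
        "r \<in> R - (T - {t}) \<Longrightarrow> g' (m' r) = g' r" "finite (g' -` {l})" for r l
        unfolding R using m' by auto
      show "(U - {u}) \<inter> m' ` (R - (T - {t})) = {}"
        unfolding R using m'(3) unmatched u(4) by blast
    qed
    moreover have "\<not> U - {u} \<lesssim> T - {t}"
    proof
      assume "U - {u} \<lesssim> T - {t}"
      then have "insert u (U - {u}) \<lesssim> insert t (T - {t})" by (rule insert_lepoll_cong) simp
      then show False using less.prems(3) u(1) xt(3) by (simp add: insert_absorb)
    qed
    moreover have "card (T - {t}) < card T" using less.prems(1) xt(3) by (meson card_Diff1_less)
    ultimately have "obstructed E (U - {u})" using less.hyps less.prems(1) by blast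
    then show ?thesis by (rule obstructed_mono) blast
  qed
qed

section \<open>Unions bounded by an infinite set\<close>

lemma lepoll_iff_ordLeq: "A \<lesssim> B \<longleftrightarrow> (card_of A, card_of B) \<in> ordLeq"
  unfolding lepoll_def by (rule card_of_ordLeq)

lemma UN_lepoll_infinite:
  assumes "infinite T" "I \<lesssim> T" "\<And>i. i \<in> I \<Longrightarrow> S i \<lesssim> T"
  shows "(\<Union>i\<in>I. S i) \<lesssim> T"
  using assms card_of_UNION_ordLeq_infinite unfolding lepoll_iff_ordLeq by blast

lemma Un_lepoll_infinite:
  assumes "infinite T" "A \<lesssim> T" "B \<lesssim> T"
  shows "A \<union> B \<lesssim> T"
  using UN_lepoll_infinite[of T "UNIV :: bool set" "\<lambda>b. if b then A else B"] assms
    finite_lepoll_infinite[of T "UNIV :: bool set"] by (auto simp: UNIV_bool Un_commute)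

section \<open>Infinitely many unmatched right vertices\<close>

context labelled_matching
begin

definition linking :: "'v \<Rightarrow> 'v \<times> 'v list \<Rightarrow> bool" where
  "linking y = (\<lambda>(u, rs). u \<in> U \<and> alt_walk E m u (rs @ [y]) \<and> distinct rs \<and> set rs \<subseteq> R - T)"

text \<open>The label of the target is left out: the walks have to avoid a set \<open>K\<close> that
  contains the labels of their targets.\<close>

definition labels :: "'v \<times> 'v list \<Rightarrow> 'v set" where
  "labels = (\<lambda>(u, rs). g ` insert u (set rs))"

definition popular :: "'v \<Rightarrow> bool" where
  "popular y \<longleftrightarrow> (\<forall>Z. Z \<lesssim> T \<longrightarrow> (\<exists>w. linking y w \<and> labels w \<inter> Z = {}))"

lemma vimage_lepoll:
  assumes "infinite T" "K \<lesssim> T"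
  shows "g -` K \<lesssim> T"
proof -
  have "g -` K = (\<Union>l\<in>K. g -` {l})" by auto
  then show ?thesis using assms fibre
    by (metis (no_types, lifting) UN_lepoll_infinite finite_lepoll_infinite)
qed

text \<open>Closing off: start with the labels of \<open>T\<close> and repeatedly add a witness of
  unpopularity for each unpopular vertex whose label is present. Finite fibres keep all countably
  many stages within the size of \<open>T\<close>.\<close>

lemma closed_label_set:
  assumes inf: "infinite T"
  obtains K where "K \<lesssim> T" "g ` T \<subseteq> K"
    "\<And>y w. g y \<in> K \<Longrightarrow> \<not> popular y \<Longrightarrow> linking y w \<Longrightarrow> labels w \<inter> K \<noteq> {}"
proof -
  have "\<forall>y. \<exists>Z. Z \<lesssim> T \<and> (\<not> popular y \<longrightarrow> (\<forall>w. linking y w \<longrightarrow> labels w \<inter> Z \<noteq> {}))"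
    unfolding popular_def by (metis empty_lepoll)
  then obtain Z where Z: "\<And>y. Z y \<lesssim> T"
    "\<And>y w. \<not> popular y \<Longrightarrow> linking y w \<Longrightarrow> labels w \<inter> Z y \<noteq> {}" by metis
  define F where "F K = K \<union> (\<Union>y\<in>g -` K. Z y)" for K
  define K where "K n = (F ^^ n) (g ` T)" for n :: nat
  have small: "K n \<lesssim> T" for n
  proof (induction n)
    case 0
    then show ?case by (simp add: K_def image_lepoll)
  next
    case (Suc n)
    then show ?case unfolding K_def funpow.simps o_apply F_def
      using inf vimage_lepoll Z(1) by (intro Un_lepoll_infinite UN_lepoll_infinite) auto
  qed
  show ?thesis
  proof (rule that[of "\<Union>n. K n"])
    show "(\<Union>n. K n) \<lesssim> T" using small inf infinite_le_lepoll by (intro UN_lepoll_infinite) auto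
    have "K 0 = g ` T" by (simp add: K_def)
    then show "g ` T \<subseteq> (\<Union>n. K n)" by blast
    show "labels w \<inter> (\<Union>n. K n) \<noteq> {}" if "g y \<in> (\<Union>n. K n)" "\<not> popular y" "linking y w" for y w
    proof -
      from that(1) obtain n where "g y \<in> K n" by blast
      then have "Z y \<subseteq> K (Suc n)" unfolding K_def funpow.simps o_apply F_def by auto
      then have "Z y \<subseteq> (\<Union>n. K n)" by blast
      then show ?thesis using Z(2)[OF that(2,3)] by (meson disjoint_iff subsetD)
    qed
  qed
qed

text \<open>Transfinite recursion along a well-order: at each \<open>y\<close>, popularity provides
  a walk avoiding \<open>K\<close> and all labels used before.\<close>

lemma disjoint_linkings:
  assumes inf: "infinite T" and Y: "Y \<lesssim> T" and K: "K \<lesssim> T" and pop: "\<And>y. y \<in> Y \<Longrightarrow> popular y"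
  obtains w where "\<And>y. y \<in> Y \<Longrightarrow> linking y (w y)" "\<And>y. y \<in> Y \<Longrightarrow> labels (w y) \<inter> K = {}"
    "disjoint_family_on (\<lambda>y. labels (w y)) Y"
proof -
  obtain r :: "'v rel" where r: "Well_order r" "Field r = UNIV" by (metis well_ordering)
  let ?P = "\<lambda>f y v. y \<in> Y \<longrightarrow> linking y v \<and> labels v \<inter> K = {} \<and>
    (\<forall>z\<in>Y. (z, y) \<in> r - Id \<longrightarrow> labels v \<inter> labels (f z) = {})"
  have "\<exists>f. \<forall>y. ?P f y (f y)"
  proof (rule dependent_wf_choice)
    show "wf (r - Id)" using r(1) unfolding well_order_on_def by blast
    show "?P f x v = ?P h x v" if "\<And>z. (z, x) \<in> r - Id \<Longrightarrow> f z = h z" for f h x v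
      using that by auto
    show "\<exists>v. ?P f y v" for y f
    proof (cases "y \<in> Y")
      case True
      \<comment> \<open>The function \<open>f\<close> is arbitrary here, but each label set is
        finite, so even the union over all of \<open>Y\<close>, not just over predecessors of
        \<open>y\<close>, is small enough.\<close>
      have "labels v \<lesssim> T" for v
        unfolding labels_def using inf by (auto intro: finite_lepoll_infinite split: prod.split)
      then have "K \<union> (\<Union>z\<in>Y. labels (f z)) \<lesssim> T"
        using inf Y K by (intro Un_lepoll_infinite UN_lepoll_infinite) auto
      then obtain v where "linking y v" "labels v \<inter> (K \<union> (\<Union>z\<in>Y. labels (f z))) = {}"
        using pop[OF True] unfolding popular_def by blast
      then show ?thesis by blast
    qed blast
  qed
  then obtain w where w: "\<And>y. ?P w y (w y)" by blast
  have "labels (w y) \<inter> labels (w z) = {}" if "y \<in> Y" "z \<in> Y" "y \<noteq> z" for y z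
  proof -
    have "(y, z) \<in> r \<or> (z, y) \<in> r"
      using r that(3) unfolding well_order_on_def linear_order_on_def total_on_def by auto
    then show ?thesis using w that by blast
  qed
  then have "disjoint_family_on (\<lambda>y. labels (w y)) Y" unfolding disjoint_family_on_def by blast
  then show ?thesis using w by (intro that[of w]) blast+
qed

lemma obstructed_if_infinite:
  assumes inf: "infinite T" and T: "\<not> U \<lesssim> T"
  shows "obstructed E U"
proof -
  obtain K where K: "K \<lesssim> T" "g ` T \<subseteq> K"
    and closed: "\<And>y w. g y \<in> K \<Longrightarrow> \<not> popular y \<Longrightarrow> linking y w \<Longrightarrow> labels w \<inter> K \<noteq> {}"
    by (rule closed_label_set[OF inf]) blast
  \<comment> \<open>As \<open>m\<close> preserves labels, walks from \<open>V\<close> through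
    \<open>N\<close> never meet a label in \<open>K\<close> before their target.\<close>
  define N where "N = R - g -` K"
  define V where "V = U - g -` K"
  let ?C = "reach E m N V"
  define Y where "Y = neighbours E ?C \<inter> g -` K"
  have N: "N \<subseteq> R - T" using K(2) unfolding N_def by auto
  have C: "g x \<notin> K" if "x \<in> ?C" for x
    using that N label unfolding N_def V_def by induction auto
  \<comment> \<open>The walk that reaches \<open>y\<close> avoids \<open>K\<close>, whereas
    \<open>closed\<close> makes every walk to an unpopular vertex with label in \<open>K\<close>
    meet \<open>K\<close>.\<close>
  have pop: "popular y" if "y \<in> Y" for y
  proof (rule ccontr)
    assume unpop: "\<not> popular y"
    from that obtain x where "x \<in> ?C" "E x y" and y: "g y \<in> K" unfolding Y_def neighbours_def by blast
    then obtain u rs where u: "u \<in> V" "alt_walk E m u (rs @ [y])" "distinct rs" "set rs \<subseteq> N"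
      using reach_edge_alt_walk by metis
    then have "linking y (u, rs)" using N unfolding linking_def V_def by auto
    moreover have "labels (u, rs) \<inter> K = {}" using u(1,4) unfolding labels_def V_def N_def by auto
    ultimately show False using closed[OF y unpop] by blast
  qed
  have small: "Y \<lesssim> T"
    using vimage_lepoll[OF inf K(1)] unfolding Y_def
    by (meson Int_lower2 lepoll_trans subset_imp_lepoll)
  obtain w where link: "\<And>y. y \<in> Y \<Longrightarrow> linking y (w y)" and avoid: "\<And>y. y \<in> Y \<Longrightarrow> labels (w y) \<inter> K = {}"
    and disj: "disjoint_family_on (\<lambda>y. labels (w y)) Y"
    using disjoint_linkings[OF inf small K(1) pop] by blast
  define u where "u y = fst (w y)" for y
  define rs where "rs y = snd (w y)" for y
  have w: "w y = (u y, rs y)" for y by (simp add: u_def rs_def)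
  \<comment> \<open>The vertices with labels in \<open>K\<close> and the starts of the chosen walks
    together are at most as many as \<open>T\<close>, so they cannot exhaust
    \<open>U\<close>.\<close>
  have "\<not> V \<subseteq> u ` Y"
  proof
    assume "V \<subseteq> u ` Y"
    then have "U \<subseteq> g -` K \<union> u ` Y" unfolding V_def by blast
    moreover have "g -` K \<union> u ` Y \<lesssim> T"
      using inf vimage_lepoll[OF inf K(1)] small lepoll_trans[OF image_lepoll]
      by (intro Un_lepoll_infinite) auto
    ultimately show False using T lepoll_trans subset_imp_lepoll by blast
  qed
  then obtain a where a: "a \<in> V" "a \<notin> u ` Y" by blast
  have rsN: "set (rs y) \<subseteq> N" and uV: "u y \<in> V" if "y \<in> Y" for y
    using link[OF that] avoid[OF that] unfolding w linking_def labels_def N_def V_def by auto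
  have "obstructed E V"
  proof (rule obstructed_by_augmenting[where g = g and m = m and u = u and rs = rs and a = a])
    show "inj_on m N" using inj N by (rule inj_on_subset)
    show "Y \<inter> N = {}" unfolding Y_def N_def by blast
    show "E (m r) r" "g (m r) = g r" if "r \<in> N" for r using that N edge label by auto
    show "V \<inter> m ` N = {}" using unmatched N unfolding V_def by blast
    show "neighbours E ?C \<subseteq> N \<union> Y" using range unfolding neighbours_def N_def Y_def by blast
    show "?C \<inter> Y = {}" using C unfolding Y_def by blast
    show "alt_walk E m (u y) (rs y @ [y])" "distinct (rs y)" if "y \<in> Y" for y
      using link[OF that] unfolding w linking_def by auto
    show "disjoint_family_on (\<lambda>y. g ` insert (u y) (set (rs y))) Y"
      using disj unfolding w labels_def by simp
  qed (use fibre a rsN uV in auto)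
  then show ?thesis by (rule obstructed_mono) (simp add: V_def)
qed

end

section \<open>Webs\<close>

lemma set_vwalk_arcs: "set (vwalk_arcs p) = {(p ! i, p ! Suc i) |i. Suc i < length p}"
proof (induction p rule: vwalk_arcs.induct)
  case (3 x y xs)
  have ex_Suc: "(\<exists>i. Q i) \<longleftrightarrow> Q 0 \<or> (\<exists>i. Q (Suc i))" for Q :: "nat \<Rightarrow> bool"
    by (metis not0_implies_Suc)
  have "(\<exists>i. e = ((x # y # xs) ! i, (x # y # xs) ! Suc i) \<and> Suc i < length (x # y # xs)) \<longleftrightarrow>
      e = (x, y) \<or> (\<exists>i. e = ((y # xs) ! i, (y # xs) ! Suc i) \<and> Suc i < length (y # xs))" for e
    by (subst ex_Suc) (simp only: nth_Cons_0 nth_Cons_Suc length_Cons Suc_less_eq zero_less_Suc simp_thms)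
  then show ?case unfolding vwalk_arcs.simps list.set 3 by (intro set_eqI) (simp only: mem_Collect_eq insert_iff)
qed auto

lemma dpath_arc:
  assumes "dpath D p" "Suc i < length p"
  shows "(p ! i, p ! Suc i) \<in> parcs D"
  using assms unfolding vpath_def vwalk_def set_vwalk_arcs by auto

lemma path_between_ends:
  assumes "path_between D X Y p"
  shows "dpath D p" "p \<noteq> []" "hd p \<in> X" "last p \<in> Y"
  using assms unfolding path_between_def vpath_def vwalk_def by auto

text \<open>Cancel \<open>m\<close> on both sides; if one side runs out first, its start would be in
  the image of \<open>N\<close>. With \<open>s = t\<close> this keeps a path from repeating
  vertices, with \<open>s \<noteq> t\<close> it keeps two paths disjoint.\<close>

lemma funpow_inj_on_cancel:
  assumes "(m ^^ i) s = (m ^^ j) t" "inj_on m N" "\<And>k. k < i \<Longrightarrow> (m ^^ k) s \<in> N"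
    "\<And>k. k < j \<Longrightarrow> (m ^^ k) t \<in> N" "s \<notin> m ` N" "t \<notin> m ` N"
  shows "i = j \<and> s = t"
  using assms
proof (induction i arbitrary: j)
  case 0
  then show ?case by (cases j) auto
next
  case (Suc i)
  show ?case
  proof (cases j)
    case 0
    then show ?thesis using Suc.prems(1,3,6) by auto
  next
    case (Suc k)
    have "(m ^^ i) s = (m ^^ k) t"
      using Suc.prems(1) Suc.prems(3)[of i] Suc.prems(4)[of k] inj_onD[OF Suc.prems(2)]
      unfolding Suc by simp
    then show ?thesis using Suc.IH[of k] Suc.prems(2-6) unfolding Suc by auto
  qed
qed

context web
begin

text \<open>\<open>x\<close> is a left copy and \<open>r\<close> a right copy; vertices of
  \<open>B\<close> have no left copy and those of \<open>A\<close> no right copy.\<close>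

definition split_edge :: "'v \<Rightarrow> 'v \<Rightarrow> bool" where
  "split_edge x r \<longleftrightarrow> x \<in> pverts D - B \<and> r \<in> pverts D - A \<and> (x = r \<or> (x, r) \<in> parcs D)"

section \<open>From an obstruction to a hindrance\<close>

lemma hindered_if_obstructed:
  assumes "obstructed split_edge U" and U: "U \<subseteq> A - B"
  shows "hindered D A B"
proof -
  obtain C m a and g :: "'v \<Rightarrow> 'v" where obs: "a \<in> U \<inter> C \<and> C \<subseteq> U \<union> {x. \<exists>r. split_edge x r} \<and>
     inj_on m (neighbours split_edge C) \<and> m ` neighbours split_edge C \<subseteq> C - {a} \<and>
     (\<forall>r\<in>neighbours split_edge C. split_edge (m r) r) \<and> (\<forall>l. finite (g -` {l})) \<and>
     (\<forall>r\<in>C \<inter> neighbours split_edge C. g (m r) = g r)"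
    using assms(1) unfolding obstructed_def by (elim exE)
  define N where "N = neighbours split_edge C"
  have a: "a \<in> U \<inter> C" and C: "C \<subseteq> U \<union> {x. \<exists>r. split_edge x r}" and inj: "inj_on m N"
    and img: "m ` N \<subseteq> C - {a}" and edge: "\<And>r. r \<in> N \<Longrightarrow> split_edge (m r) r"
    and fin: "\<And>l. finite (g -` {l})" and lab: "\<And>r. r \<in> C \<Longrightarrow> r \<in> N \<Longrightarrow> g (m r) = g r"
    using obs unfolding N_def by blast+
  have CV: "C \<subseteq> pverts D - B" using C U A_subset unfolding split_edge_def by blast
  have N_sub: "N \<subseteq> pverts D - A" unfolding N_def neighbours_def split_edge_def by blast
  \<comment> \<open>The edge between its two copies makes each vertex of \<open>C\<close> outside
    \<open>A\<close> its own neighbour, so \<open>m\<close> can be iterated until \<open>A\<close>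
    is reached.\<close>
  have CN: "x \<in> N" if "x \<in> C" "x \<notin> A" for x
    using that CV unfolding N_def neighbours_def split_edge_def by blast
  have mC: "m r \<in> C" "m r \<noteq> a" if "r \<in> N" for r using img that by blast+
  \<comment> \<open>\<open>N - C\<close> catches the paths that leave \<open>C\<close>, and
    \<open>A - C\<close> those that start outside it.\<close>
  define S where "S = (N - C) \<union> (A - C)"
  have S_C: "s \<notin> m ` N" if "s \<in> S" for s using that mC unfolding S_def by blast
  \<comment> \<open>Otherwise the iterates are distinct and share one label, against finite fibres.
    The label is constant only from \<open>m s\<close> on, because \<open>s\<close> itself lies
    outside \<open>C\<close>.\<close>
  have ex: "\<exists>n. (m ^^ n) s \<in> A" if s: "s \<in> S" for s
  proof (rule ccontr)
    assume never: "\<not> (\<exists>n. (m ^^ n) s \<in> A)"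
    have N: "(m ^^ n) s \<in> N" for n
    proof (induction n)
      case 0
      have "s \<notin> A" using never by (metis funpow_0)
      then show ?case using s unfolding S_def by simp
    next
      case (Suc n)
      then show ?case using mC(1) CN never by (metis funpow.simps(2) o_apply)
    qed
    have "g ((m ^^ Suc n) s) = g (m s)" for n
    proof (induction n)
      case (Suc n)
      have "(m ^^ Suc n) s \<in> C" using mC(1) N[of n] by simp
      then have "g (m ((m ^^ Suc n) s)) = g ((m ^^ Suc n) s)" using lab N by blast
      then show ?case using Suc by simp
    qed simp
    then have "range (\<lambda>n. (m ^^ Suc n) s) \<subseteq> g -` {g (m s)}" by auto
    then have "finite (range (\<lambda>n. (m ^^ Suc n) s))" using fin finite_subset by blast
    moreover have "inj (\<lambda>n. (m ^^ Suc n) s)"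
    proof (rule injI)
      fix i j assume "(m ^^ Suc i) s = (m ^^ Suc j) s"
      from funpow_inj_on_cancel[OF this inj] show "i = j" using N S_C[OF s] by simp
    qed
    ultimately show False using finite_imageD by blast
  qed
  define len where "len s = (LEAST n. (m ^^ n) s \<in> A)" for s
  have len: "(m ^^ len s) s \<in> A" if "s \<in> S" for s
    unfolding len_def using ex[OF that] by (rule LeastI_ex)
  have before: "(m ^^ k) s \<notin> A" if "k < len s" for s k
    using that not_less_Least unfolding len_def by blast
  have in_N: "(m ^^ k) s \<in> N" if "s \<in> S" "k < len s" for s k
    using that(2)
  proof (induction k)
    case 0
    then show ?case using before[of 0 s] that(1) unfolding S_def by simp
  next
    case (Suc k)
    then show ?case using mC(1) CN before[of "Suc k" s] by simp
  qed
  have in_C: "(m ^^ k) s \<in> C" "(m ^^ k) s \<noteq> a" if "s \<in> S" "0 < k" "k \<le> len s" for s k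
    using that in_N[OF that(1), of "k - 1"] mC by (cases k; simp)+
  have cancel: "i = j \<and> s = t"
    if "(m ^^ i) s = (m ^^ j) t" "s \<in> S" "t \<in> S" "i \<le> len s" "j \<le> len t" for i j s t
    using funpow_inj_on_cancel[OF that(1) inj] in_N S_C that by simp
  \<comment> \<open>Iterating \<open>m\<close> runs against the arcs, so the iterates are listed
    from \<open>len s\<close> down to 0.\<close>
  define p where "p s = map (\<lambda>i. (m ^^ (len s - i)) s) [0..<Suc (len s)]" for s
  have nth: "p s ! i = (m ^^ (len s - i)) s" if "i \<le> len s" for s i
    unfolding p_def using that by (simp del: upt_Suc)
  have length: "length (p s) = Suc (len s)" for s unfolding p_def by simp
  have p_hd: "hd (p s) = (m ^^ len s) s" for s
    using nth[of 0 s] length[of s] by (simp add: hd_conv_nth flip: length_0_conv)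
  have p_last: "last (p s) = s" for s
    using nth[of "len s" s] length[of s] by (simp add: last_conv_nth flip: length_0_conv)
  have set_p: "\<exists>i\<le>len s. v = (m ^^ i) s" if "v \<in> set (p s)" for v s
    using that unfolding p_def by (auto simp del: upt_Suc) (metis diff_le_self)
  have S_V: "S \<subseteq> pverts D" using N_sub A_subset unfolding S_def by blast
  have dpath: "dpath D (p s)" if s: "s \<in> S" for s
    unfolding vpath_def vwalk_def with_proj_simps set_vwalk_arcs
  proof (intro conjI subsetI)
    show "distinct (p s)"
      unfolding distinct_conv_nth length using nth[of _ s] cancel[OF _ s s]
      by (metis diff_diff_cancel diff_le_self less_Suc_eq_le)
    show "p s \<noteq> []" using length[of s] by auto
    show "v \<in> pverts D" if v: "v \<in> set (p s)" for v
    proof -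
      obtain i where i: "i \<le> len s" "v = (m ^^ i) s" using set_p[OF v] by blast
      then show ?thesis using in_C(1)[OF s, of i] CV S_V s by (cases i) auto
    qed
    show "e \<in> parcs D" if "e \<in> {(p s ! i, p s ! Suc i) |i. Suc i < length (p s)}" for e
    proof -
      from that obtain i where i: "i < len s" "e = (p s ! i, p s ! Suc i)" unfolding length by auto
      define k where "k = len s - Suc i"
      have k: "k < len s" "len s - i = Suc k" using i unfolding k_def by auto
      then have e: "e = (m ((m ^^ k) s), (m ^^ k) s)"
        using i nth[of i s] nth[of "Suc i" s] by (simp add: k_def)
      \<comment> \<open>\<open>split_edge\<close> also joins a vertex to itself; distinct iterates
        leave only a genuine arc.\<close>
      have "(m ^^ Suc k) s \<noteq> (m ^^ k) s" using cancel[OF _ s s, of "Suc k" k] k by auto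
      then show ?thesis using edge[OF in_N[OF s k(1)]] unfolding e split_edge_def by auto
    qed
  qed
  have between: "path_between D A S (p s)" if s: "s \<in> S" for s
  proof (cases "len s = 0")
    case True
    then have "p s = [s]" unfolding p_def by simp
    then show ?thesis using dpath[OF s] len[OF s] s True unfolding path_between_def by auto
  next
    case False
    have "p s ! i \<notin> A \<union> S" if "0 < i" "i < len s" for i
      using nth[of i s] that in_C(1)[OF s, of "len s - i"] before[of "len s - i" s]
      unfolding S_def by auto
    then show ?thesis
      unfolding path_between_def length p_hd p_last using False dpath[OF s] len[OF s] s by auto
  qed
  have "separator D A B S"
    unfolding separator_def
  proof (intro conjI allI impI S_V)
    fix q assume q: "path_between D A B q"
    note ends = path_between_ends[OF q]
    show "set q \<inter> S \<noteq> {}"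
    proof (cases "hd q \<in> C")
      case False
      then have "hd q \<in> S" using ends(3) unfolding S_def by blast
      then show ?thesis using hd_in_set[OF ends(2)] by blast
    next
      case True
      \<comment> \<open>\<open>q\<close> ends in \<open>B\<close>, which \<open>C\<close> avoids, so
        it has a first vertex outside \<open>C\<close>; the arc entering that vertex puts it into
        \<open>N\<close>.\<close>
      have "\<not> (\<forall>i<length q. q ! i \<in> C)"
        using ends(2,4) CV by (metis DiffE diff_less last_conv_nth length_greater_0_conv subsetD zero_less_one)
      then have ex: "\<exists>i. i < length q \<and> q ! i \<notin> C" by blast
      define i where "i = (LEAST i. i < length q \<and> q ! i \<notin> C)"
      have i: "i < length q" "q ! i \<notin> C" using LeastI_ex[OF ex] unfolding i_def by blast+
      have i_min: "q ! j \<in> C" if "j < i" for j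
        using not_less_Least[of j "\<lambda>i. i < length q \<and> q ! i \<notin> C"] that i(1) unfolding i_def by auto
      have "i \<noteq> 0" using i(2) True ends(2) by (metis hd_conv_nth)
      then obtain j where j: "i = Suc j" using not0_implies_Suc by blast
      have arc: "(q ! j, q ! i) \<in> parcs D" using dpath_arc[OF ends(1), of j] i(1) j by simp
      have "q ! j \<in> C" using i_min j by simp
      moreover have "q ! i \<in> pverts D"
        using ends(1) i(1) unfolding vpath_def vwalk_def by (auto dest: nth_mem)
      moreover have "q ! i \<notin> A" using arc no_arc_into_A by blast
      ultimately have "q ! i \<in> N"
        using arc CV unfolding N_def neighbours_def split_edge_def by blast
      then have "q ! i \<in> S" using i(2) unfolding S_def by blast
      then show ?thesis using nth_mem[OF i(1)] by blast
    qed
  qed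
  moreover have "vertex_disjoint (p ` S)"
    unfolding vertex_disjoint_def
  proof (rule pairwiseI)
    fix q q' assume "q \<in> p ` S" "q' \<in> p ` S" "q \<noteq> q'"
    then obtain s t where st: "s \<in> S" "t \<in> S" "s \<noteq> t" "q = p s" "q' = p t" by blast
    then show "disjnt (set q) (set q')"
      unfolding disjnt_iff using set_p cancel by metis
  qed
  moreover have "initials (p ` S) \<subset> A"
  proof -
    \<comment> \<open>The initial vertex is either \<open>s\<close>, which lies outside
      \<open>C\<close>, or a value of \<open>m\<close>, which avoids \<open>a\<close>.\<close>
    have "hd (p s) \<noteq> a" if s: "s \<in> S" for s
      using in_C(2)[OF s, of "len s"] s a unfolding p_hd S_def by (cases "len s") auto
    moreover have "hd (p s) \<in> A" if "s \<in> S" for s using len[OF that] unfolding p_hd .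
    ultimately have "initials (p ` S) \<subseteq> A - {a}" by blast
    then show ?thesis using a U by blast
  qed
  moreover have "terminals (p ` S) = S" using p_last by (auto simp: image_image)
  moreover have "\<forall>q\<in>p ` S. path_between D A S q" using between by blast
  ultimately have "hindrance D A B (p ` S)" unfolding hindrance_def by (intro exI[of _ S] conjI)
  then show ?thesis unfolding hindered_def by (rule exI)
qed

section \<open>From a partial linkage to a labelled matching\<close>

lemma partial_linkage_matching:
  assumes P: "partial_linkage D A B P"
  obtains m g where "labelled_matching split_edge (pverts D - A) (B - A - terminals P)
    (A - B - initials P) m g"
proof -
  have path: "path_between D A B p" if "p \<in> P" for p
    using P that unfolding partial_linkage_def by blast
  have same: "p = q" if "p \<in> P" "q \<in> P" "v \<in> set p" "v \<in> set q" for p q v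
    using P that unfolding partial_linkage_def vertex_disjoint_def pairwise_def disjnt_iff by blast
  define pr where "pr x r \<longleftrightarrow> (\<exists>p\<in>P. \<exists>i. Suc i < length p \<and> p ! i = x \<and> p ! Suc i = r)" for x r
  have prI: "pr (p ! i) (p ! Suc i)" if "p \<in> P" "Suc i < length p" for p i
    using that unfolding pr_def by blast
  have pr_unique: "x = y \<longleftrightarrow> r = s" if pr: "pr x r" "pr y s" for x y r s
  proof -
    obtain p i where p: "p \<in> P" "Suc i < length p" "p ! i = x" "p ! Suc i = r"
      using pr(1) unfolding pr_def by blast
    obtain q j where q: "q \<in> P" "Suc j < length q" "q ! j = y" "q ! Suc j = s"
      using pr(2) unfolding pr_def by blast
    have dist: "distinct p" using path_between_ends(1)[OF path[OF p(1)]] unfolding vpath_def by blast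
    have mem: "x \<in> set p" "r \<in> set p" "y \<in> set q" "s \<in> set q"
      using p q nth_mem Suc_lessD by metis+
    show ?thesis
    proof (cases "p = q")
      case True
      then show ?thesis using p q dist nth_eq_iff_index_eq[OF dist] by (metis Suc_lessD nat.inject)
    next
      case False
      then show ?thesis using mem same[OF p(1) q(1)] by blast
    qed
  qed
  \<comment> \<open>A vertex without predecessor is sent to itself; the initial vertices of
    \<open>P\<close> among these lie in \<open>A\<close> and have no right copy.\<close>
  define m where "m r = (if \<exists>x. pr x r then SOME x. pr x r else r)" for r
  have m_pr: "m r = x" if "pr x r" for x r
    unfolding m_def using that pr_unique by (metis someI)
  have m_id: "m r = r" if "\<nexists>x. pr x r" for r using that unfolding m_def by simp
  have pr_arc: "(x, r) \<in> parcs D" if "pr x r" for x r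
    using that dpath_arc path_between_ends(1)[OF path] unfolding pr_def by blast
  have pr_R: "x \<in> pverts D - B" "r \<in> pverts D - A" if "pr x r" for x r
    using pr_arc[OF that] in_arcsD1 in_arcsD2 no_arc_into_A no_arc_from_B by blast+
  \<comment> \<open>Vertices of \<open>B\<close> cannot be their own partners. A terminal vertex
    outside \<open>A\<close> is not initial on its path, so it has a predecessor.\<close>
  have pr_last: "\<exists>x. pr x r" if r: "r \<in> terminals P" "r \<notin> A" for r
  proof -
    obtain p where p: "p \<in> P" "r = last p" using r(1) by blast
    note ends = path_between_ends[OF path[OF p(1)]]
    have "length p \<noteq> 1" using ends(2,3) r(2) p(2) by (auto simp: length_Suc_conv)
    then have "Suc (length p - 2) < length p" "Suc (length p - 2) = length p - 1"
      using ends(2) by (cases p; cases "tl p"; simp)+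
    then show ?thesis using p ends(2) unfolding pr_def by (metis last_conv_nth)
  qed
  have pr_hd: "x \<in> initials P" if pr: "pr x r" and no_pr: "\<nexists>w. pr w x" for x r
  proof -
    obtain p i where p: "p \<in> P" "Suc i < length p" "p ! i = x" using pr unfolding pr_def by blast
    have "i = 0"
    proof (rule ccontr)
      assume "i \<noteq> 0"
      then obtain j where "i = Suc j" using not0_implies_Suc by blast
      then have "pr (p ! j) x" using prI[of p j] p by simp
      then show False using no_pr by blast
    qed
    then have "x = hd p" using p path_between_ends(2)[OF path] by (simp add: hd_conv_nth)
    then show ?thesis using p(1) by blast
  qed
  have hd_A: "x \<in> A" if "x \<in> initials P" for x using that path_between_ends(3)[OF path] by blast
  \<comment> \<open>Paths are named by their initial vertices and vertices off \<open>P\<close> by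
    themselves, so a fibre lies in one path or has at most one element.\<close>
  define g where "g v = (if \<exists>p\<in>P. v \<in> set p then hd (SOME p. p \<in> P \<and> v \<in> set p) else v)" for v
  have g_path: "g v = hd p" if "p \<in> P" "v \<in> set p" for p v
  proof -
    have "(SOME p. p \<in> P \<and> v \<in> set p) = p"
      using that same by (intro some_equality) blast+
    then show ?thesis using that unfolding g_def by auto
  qed
  have g_off: "g v = v" if "\<And>p. p \<in> P \<Longrightarrow> v \<notin> set p" for v using that unfolding g_def by auto
  have "labelled_matching split_edge (pverts D - A) (B - A - terminals P) (A - B - initials P) m g"
  proof
    show "r \<in> pverts D - A" if "split_edge x r" for x r using that unfolding split_edge_def by blast
    show "split_edge (m r) r" if "r \<in> pverts D - A - (B - A - terminals P)" for r
    proof (cases "\<exists>x. pr x r")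
      case True
      then obtain x where "pr x r" by blast
      then show ?thesis using m_pr pr_arc pr_R unfolding split_edge_def by metis
    next
      case False
      then have "r \<notin> B" using pr_last[of r] that by blast
      then show ?thesis using m_id[OF False] that unfolding split_edge_def by simp
    qed
    \<comment> \<open>A predecessor without a predecessor of its own is initial, hence in
      \<open>A\<close>; so no right vertex matched to itself is also the predecessor of another
      one.\<close>
    have mixed: False if "pr x r" "\<nexists>w. pr w x" "x \<notin> A" for x r
      using pr_hd[OF that(1,2)] hd_A that(3) by blast
    show "inj_on m (pverts D - A - (B - A - terminals P))"
    proof (rule inj_onI)
      fix r s assume r: "r \<in> pverts D - A - (B - A - terminals P)"
        and s: "s \<in> pverts D - A - (B - A - terminals P)" and eq: "m r = m s"
      consider x y where "pr x r" "pr y s" | x where "pr x r" "\<nexists>w. pr w s"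
        | x where "pr x s" "\<nexists>w. pr w r" | "\<nexists>w. pr w r" "\<nexists>w. pr w s" by blast
      then show "r = s"
      proof cases
        case 1
        then show ?thesis using eq m_pr pr_unique by metis
      next
        case 2
        then have "x = s" using eq m_pr m_id by metis
        then show ?thesis using mixed[of s r] 2 s by blast
      next
        case 3
        then have "x = r" using eq m_pr m_id by metis
        then show ?thesis using mixed[of r s] 3 r by blast
      next
        case 4
        then show ?thesis using eq m_id by metis
      qed
    qed
    have "m r \<notin> A - B - initials P" if r: "r \<in> pverts D - A" for r
    proof (cases "\<exists>x. pr x r")
      case True
      then obtain x where x: "pr x r" by blast
      show ?thesis
      proof (cases "\<exists>w. pr w x")
        case True
        then show ?thesis using pr_R(2) m_pr[OF x] by blast
      next
        case False
        then show ?thesis using pr_hd[OF x] m_pr[OF x] by blast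
      qed
    next
      case False
      then show ?thesis using m_id[OF False] r by simp
    qed
    then show "(A - B - initials P) \<inter> m ` (pverts D - A - (B - A - terminals P)) = {}" by blast
    show "g (m r) = g r" for r
    proof (cases "\<exists>x. pr x r")
      case True
      then obtain x where x: "pr x r" by blast
      then obtain p where "p \<in> P" "x \<in> set p" "r \<in> set p"
        unfolding pr_def by (metis Suc_lessD nth_mem)
      then show ?thesis using g_path m_pr[OF x] by simp
    next
      case False
      then show ?thesis using m_id[OF False] by simp
    qed
    show "finite (g -` {l})" for l
    proof (cases "\<exists>p\<in>P. l \<in> set p")
      case True
      then obtain p where p: "p \<in> P" "l \<in> set p" by blast
      have "v \<in> set p" if v: "g v = l" for v
      proof (cases "\<exists>q\<in>P. v \<in> set q")
        case True
        then obtain q where q: "q \<in> P" "v \<in> set q" by blast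
        then have "l \<in> set q" using g_path v path_between_ends(2)[OF path] by fastforce
        then show ?thesis using same[OF p(1) q(1) p(2)] q(2) by blast
      next
        case False
        then have "g v = v" using g_off by blast
        then show ?thesis using v p(2) by simp
      qed
      then have "g -` {l} \<subseteq> set p" by blast
      then show ?thesis using finite_subset by blast
    next
      case False
      have "v = l" if v: "g v = l" for v
      proof (cases "\<exists>q\<in>P. v \<in> set q")
        case True
        then obtain q where q: "q \<in> P" "v \<in> set q" by blast
        then have "l \<in> set q" using g_path v path_between_ends(2)[OF path] by fastforce
        then show ?thesis using False q(1) by blast
      next
        case no_q: False
        then have "g v = v" using g_off by blast
        then show ?thesis using v by simp
      qed
      then have "g -` {l} \<subseteq> {l}" by blast
      then show ?thesis using finite_subset by blast
    qed
  qed
  then show ?thesis by (rule that)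
qed

text \<open>
  The vertices of \<open>A \<inter> B\<close> are isolated, hence initial vertices of \<open>P\<close> iff they
  are terminal vertices, and cancel in the comparison.
\<close>

lemma wasteful_unmatched:
  assumes P: "partial_linkage D A B P" and "wasteful A B P"
  shows "\<not> A - B - initials P \<lesssim> B - A - terminals P"
proof
  assume less: "A - B - initials P \<lesssim> B - A - terminals P"
  have path: "path_between D A B p" if "p \<in> P" for p using P that unfolding partial_linkage_def by blast
  have trivial: "p = [v]" if "p \<in> P" "v \<in> A \<inter> B" "v = hd p \<or> v = last p" for p v
  proof -
    note ends = path_between_ends[OF path[OF that(1)]]
    \<comment> \<open>A nontrivial path would give \<open>v\<close> an arc out of \<open>B\<close>
      if \<open>v\<close> is initial, or into \<open>A\<close> if \<open>v\<close> is
      terminal.\<close>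
    have False if long: "Suc 0 < length p"
    proof -
      have "(hd p, p ! Suc 0) \<in> parcs D"
        using dpath_arc[OF ends(1), of 0] long ends(2) by (simp add: hd_conv_nth)
      moreover have "Suc (length p - 2) = length p - 1" using long by simp
      then have "(p ! (length p - 2), last p) \<in> parcs D"
        using dpath_arc[OF ends(1), of "length p - 2"] long ends(2) by (simp add: last_conv_nth)
      ultimately show False
        using \<open>v \<in> A \<inter> B\<close> \<open>v = hd p \<or> v = last p\<close> no_arc_into_A no_arc_from_B by blast
    qed
    then have "length p = 1" using ends(2) by (cases p; cases "tl p") auto
    then show ?thesis using that(3) by (auto simp: length_Suc_conv)
  qed
  have eq: "A \<inter> B - initials P = A \<inter> B - terminals P"
    using trivial by (auto; metis image_eqI last.simps list.sel(1))
  have "A - initials P = (A - B - initials P) \<union> (A \<inter> B - initials P)" by blast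
  also have "\<dots> \<lesssim> (B - A - terminals P) \<union> (A \<inter> B - terminals P)"
    unfolding eq using less by (intro Un_lepoll_mono) (auto simp: disjnt_def)
  also have "\<dots> = B - terminals P" by blast
  finally show False using assms(2) unfolding wasteful_def lesspoll_def by (meson lepoll_antisym)
qed

end

theorem theorem1p1:
  fixes D :: "'v pair_pre_digraph" and A B :: "'v set"
  assumes "web D A B"
    and "\<exists>P. partial_linkage D A B P \<and> wasteful A B P"
  shows "hindered D A B"
proof -
  interpret web D A B by fact
  obtain P where P: "partial_linkage D A B P" "wasteful A B P" using assms(2) by blast
  then have unmatched: "\<not> A - B - initials P \<lesssim> B - A - terminals P" by (rule wasteful_unmatched)
  obtain m g where M: "labelled_matching split_edge (pverts D - A) (B - A - terminals P)
      (A - B - initials P) m g"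
    using partial_linkage_matching[OF P(1)] by blast
  have "obstructed split_edge (A - B - initials P)"
  proof (cases "finite (B - A - terminals P)")
    case True
    then show ?thesis using M unmatched by (rule obstructed_if_finite)
  next
    case False
    then show ?thesis using unmatched by (rule labelled_matching.obstructed_if_infinite[OF M])
  qed
  then show ?thesis by (rule hindered_if_obstructed) blast
qed

end
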